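(* For Risky Stochastic Knapsack and $\varepsilon\in(0,1)$, with $k=\tilde O(1/\varepsilon)$ adaptive queries the $k$-$n$ semi-adaptivity gap $\sup_I \mathrm{ADAPT}(I)/A_k(I)$ is at most $2e+1+O(\sqrt{\varepsilon})\approx 6.44+O(\sqrt\varepsilon)$.
   Context: Stochastic Knapsack: an instance $I$ consists of $n$ items; item $i$ has a deterministic value $v_i\ge 0$ and a random nonnegative size $S_i$ drawn from a known distribution, independently across items. The knapsack capacity is $1$. A policy inserts items one at a time (each at most once) and may stop at any time; execution ends when the policy stops or at the first overflow, i.e., when the total realized size of inserted items exceeds $1$. In Risky Stochastic Knapsack, an overflow yields total value $0$; otherwise the policy receives the sum of values of the inserted items. An adaptive query is a step at which the policy observes the current total realized size of the inserted items; a policy is $k$-semi-adaptive if it makes at most $k$ adaptive queries (between queries it inserts items non-adaptively). $A_k(I)$ is the maximum expected value over $k$-semi-adaptive policies, and $\mathrm{ADAPT}(I)=A_n(I)$ is the optimal fully adaptive expected value. $\tilde O$ hides polylogarithmic factors. *)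

theory Defs
  imports "HOL-Probability.Probability"
begin

text \<open>
  An instance of Stochastic Knapsack: the items are the naturals below \<open>item_count\<close>; item \<open>i\<close>
  has value \<open>item_value i\<close>, and \<open>size_distr i\<close> is the distribution of its size. The capacity is 1.
\<close>

record knapsack =
  item_count :: nat
  item_value :: "nat \<Rightarrow> real"
  size_distr :: "nat \<Rightarrow> real measure"

definition knapsack_instance :: "knapsack \<Rightarrow> bool" where
  "knapsack_instance I \<longleftrightarrow>
     (\<forall>i<item_count I. 0 \<le> item_value I i \<and>
        real_distribution (size_distr I i) \<and> (AE x in size_distr I i. 0 \<le> x))"

text \<open>Independence of the sizes is expressed by the product measure.\<close>

definition sizes_space :: "knapsack \<Rightarrow> (nat \<Rightarrow> real) measure" where
  "sizes_space I = (\<Pi>\<^sub>M i\<in>{..<item_count I}. size_distr I i)"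

text \<open>
  Policies are decision trees. The only branching is at a \<open>Query\<close> node, whose continuation depends
  on the observed total size of the items inserted so far; a run of \<open>Insert\<close> nodes between two
  \<open>Query\<close> nodes is a non-adaptive phase.
\<close>

datatype policy =
    Stop
  | Insert nat policy
  | Query "real \<Rightarrow> policy"

text \<open>
  \<open>semi_adaptive p A k\<close>: on every branch, \<open>p\<close> inserts only items of \<open>A\<close>, each at most once, and makes
  at most \<open>k\<close> queries.
\<close>

primrec semi_adaptive :: "policy \<Rightarrow> nat set \<Rightarrow> nat \<Rightarrow> bool" where
  "semi_adaptive Stop A k \<longleftrightarrow> True"
| "semi_adaptive (Insert i p) A k \<longleftrightarrow> i \<in> A \<and> semi_adaptive p (A - {i}) k"
| "semi_adaptive (Query f) A k \<longleftrightarrow> 0 < k \<and> (\<forall>x. semi_adaptive (f x) A (k - 1))"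

text \<open>
  \<open>inserted s p x\<close>: the items inserted by \<open>p\<close> when the realized sizes are \<open>s\<close> and the current total
  size is \<open>x\<close>. An overflowing item ends the execution and is the last element of the list.
\<close>

primrec inserted :: "(nat \<Rightarrow> real) \<Rightarrow> policy \<Rightarrow> real \<Rightarrow> nat list" where
  "inserted s Stop x = []"
| "inserted s (Insert i p) x = i # (if x + s i > 1 then [] else inserted s p (x + s i))"
| "inserted s (Query f) x = inserted s (f x) x"

definition risky_payoff :: "knapsack \<Rightarrow> policy \<Rightarrow> (nat \<Rightarrow> real) \<Rightarrow> real" where
  "risky_payoff I p s =
     (let L = inserted s p 0
      in if sum_list (map s L) > 1 then 0 else sum_list (map (item_value I) L))"

text \<open>The measurability condition makes the executed sequence of items a random variable.\<close>

definition policies :: "knapsack \<Rightarrow> nat \<Rightarrow> policy set" where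
  "policies I k =
     {p. semi_adaptive p {..<item_count I} k \<and>
         (\<lambda>s. inserted s p 0) \<in> measurable (sizes_space I) (count_space UNIV)}"

definition risky_opt :: "nat \<Rightarrow> knapsack \<Rightarrow> ennreal" where
  "risky_opt k I = (SUP p\<in>policies I k. \<integral>\<^sup>+ s. ennreal (risky_payoff I p s) \<partial>sizes_space I)"

definition risky_adapt :: "knapsack \<Rightarrow> ennreal" where
  "risky_adapt I = risky_opt (item_count I) I"

text \<open>
  In \<open>ennreal\<close>, \<open>0 / 0 = 0\<close> and \<open>a / 0 = \<infinity>\<close> for \<open>a > 0\<close>. Hence an instance whose optimum is 0 does
  not contribute to the supremum, and a positive optimum against \<open>risky_opt k I = 0\<close> gives \<open>\<infinity>\<close>.
\<close>

definition risky_gap :: "nat \<Rightarrow> ennreal" where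
  "risky_gap k = (SUP I\<in>{I. knapsack_instance I}. risky_adapt I / risky_opt k I)"

end

theory Submission imports Defs begin

text \<open>
  No query is needed: already non-adaptive policies achieve the gap \<open>1 + 27 / (2 e) < 2 e + 1\<close>. Put
  \<open>w\<^sub>i = v\<^sub>i P(S\<^sub>i \<le> 1)\<close> and \<open>\<mu>\<^sub>i = E min(S\<^sub>i, 1)\<close>, and let \<open>L\<close> be the non-adaptive optimum. Single items
  give \<open>w\<^sub>i \<le> L\<close>, and Markov's inequality gives \<open>(\<Sum>\<^sub>A w) (1 - \<Sum>\<^sub>A \<mu>) \<le> L\<close> for every set \<open>A\<close>. Hence some
  dual multiplier \<open>\<lambda>\<close> of the fractional knapsack has \<open>\<Sum> (w - \<lambda> \<mu>)\<^sup>+ + \<lambda> \<le> 9 L / 2\<close>. Conversely, at used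
  capacity \<open>x\<close>, collected value \<open>V\<close> and available items \<open>A\<close>, every policy is worth at most
  \<open>L + \<lambda> potential (1 - x) ((V + \<Sum>\<^sub>A (w - \<lambda> \<mu>)\<^sup>+) / \<lambda>)\<close>, by induction on the decision tree; at the
  start this is at most \<open>L + (3 / e) (\<Sum> (w - \<lambda> \<mu>)\<^sup>+ + \<lambda>)\<close>. The summand \<open>L\<close> absorbs the
  excess of \<open>v\<^sub>i\<close> over \<open>w\<^sub>i\<close>.
\<close>

section \<open>The potential function: lower bound, monotonicity and Lipschitz bound\<close>

text \<open>
  In the limit of infinitesimal items with value equal to mean size, \<open>full_potential y\<close> is the optimal
  value in a full knapsack holding value \<open>y\<close>: continuing up to value 1 is survived with probability
  \<open>exp (y - 1)\<close>. With spare capacity \<open>a\<close>, the extreme strategy inserts items of size 0 or \<open>a\<close> until the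
  first one fills the knapsack, when \<open>y\<close> has grown by an exponential variable of mean \<open>a\<close>;
  \<open>potential a y\<close> is its value for \<open>a = 1\<close> and interpolates linearly to \<open>a = 0\<close>.
\<close>

definition full_potential :: "real \<Rightarrow> real" where
  "full_potential y = (if y \<le> 1 then exp (y - 1) else y)"

definition spare_potential :: "real \<Rightarrow> real" where
  "spare_potential y = (if y \<le> 1 then (2 - y) * exp (y - 1) else 1)"

definition potential :: "real \<Rightarrow> real \<Rightarrow> real" where
  "potential a y = full_potential y + a * spare_potential y"

lemma potential_le_1: "y \<le> 1 \<Longrightarrow> potential a y = exp (y - 1) * (1 + a * (2 - y))"
  by (simp add: potential_def full_potential_def spare_potential_def algebra_simps)

lemma potential_ge_1: "1 \<le> y \<Longrightarrow> potential a y = y + a"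
  by (auto simp: potential_def full_potential_def spare_potential_def)

text \<open>Stopping at once is dominated: the potential is never below the value already held. On
  \<open>y \<le> 1\<close> this is \<open>1 + t \<le> exp t\<close> at
  \<open>t = y - 1\<close>.\<close>

lemma potential_ge:
  assumes "0 \<le> a"
  shows "y \<le> potential a y"
proof (cases "y \<le> 1")
  case True
  have "y \<le> exp (y - 1)"
    using exp_ge_add_one_self[of "y - 1"] by simp
  also have "\<dots> \<le> exp (y - 1) * (1 + a * (2 - y))"
    using True assms by simp
  finally show ?thesis
    using True by (simp add: potential_le_1)
qed (use assms in \<open>simp add: potential_ge_1\<close>)

lemma potential_nonneg:
  assumes "0 \<le> a"
  shows "0 \<le> potential a y"
  using assms by (cases "y \<le> 1") (simp_all add: potential_le_1 potential_ge_1)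

lemma potential_le_1_has_derivative:
  "((\<lambda>y. exp (y - 1) * (1 + a * (2 - y))) has_real_derivative exp (y - 1) * (1 + a * (1 - y))) (at y)"
  by (auto intro!: derivative_eq_intros simp: algebra_simps)

text \<open>With \<open>t = 1 - y\<close>, this is \<open>1 + a * t \<le> 1 + t \<le> exp t\<close>.
  The left-hand side is the derivative of \<open>potential a\<close> on \<open>y \<le> 1\<close>, so
  the bound yields Lipschitz constant 1.\<close>

lemma potential_slope_le_1:
  assumes a: "0 \<le> a" "a \<le> 1" and y: "y \<le> (1::real)"
  shows "exp (y - 1) * (1 + a * (1 - y)) \<le> 1"
proof -
  have "a * (1 - y) \<le> 1 * (1 - y)"
    using assms by (intro mult_right_mono) auto
  hence "1 + a * (1 - y) \<le> exp (1 - y)"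
    using exp_ge_add_one_self[of "1 - y"] by (simp only: mult_1_left)
  hence "exp (y - 1) * (1 + a * (1 - y)) \<le> exp (y - 1) * exp (1 - y)"
    by simp
  thus ?thesis
    by (simp flip: exp_add)
qed

lemma potential_mono_le_1:
  assumes a: "0 \<le> a" "a \<le> 1" and y: "y \<le> z" "z \<le> 1"
  shows "potential a y \<le> potential a z"
proof -
  have "exp (y - 1) * (1 + a * (2 - y)) \<le> exp (z - 1) * (1 + a * (2 - z))"
  proof (rule DERIV_nonneg_imp_nondecreasing[OF y(1)])
    fix x assume "y \<le> x" "x \<le> z"
    thus "\<exists>d. ((\<lambda>y. exp (y - 1) * (1 + a * (2 - y))) has_real_derivative d) (at x) \<and> 0 \<le> d"
      using assms
      by (intro exI[of _ "exp (x - 1) * (1 + a * (1 - x))"] conjI potential_le_1_has_derivative) auto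
  qed
  thus ?thesis
    using y by (simp add: potential_le_1)
qed

lemma potential_lipschitz_le_1:
  assumes a: "0 \<le> a" "a \<le> 1" and y: "y \<le> z" "z \<le> 1"
  shows "potential a z \<le> potential a y + (z - y)"
proof -
  have "exp (z - 1) * (1 + a * (2 - z)) - z \<le> exp (y - 1) * (1 + a * (2 - y)) - y"
  proof (rule DERIV_nonpos_imp_nonincreasing[OF y(1)])
    fix x assume x: "y \<le> x" "x \<le> z"
    have "((\<lambda>y. exp (y - 1) * (1 + a * (2 - y)) - y) has_real_derivative
            exp (x - 1) * (1 + a * (1 - x)) - 1) (at x)"
      by (intro DERIV_diff potential_le_1_has_derivative DERIV_ident)
    thus "\<exists>d. ((\<lambda>y. exp (y - 1) * (1 + a * (2 - y)) - y) has_real_derivative d) (at x) \<and> d \<le> 0"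
      using potential_slope_le_1[OF a, of x] x y by (intro exI conjI) auto
  qed
  thus ?thesis
    using y by (simp add: potential_le_1)
qed

text \<open>The two branches are glued at \<open>y = 1\<close>, where both formulas give
  \<open>1 + a\<close>.\<close>

lemma potential_mono:
  assumes a: "0 \<le> a" "a \<le> 1" and y: "y \<le> z"
  shows "potential a y \<le> potential a z"
proof -
  consider "z \<le> 1" | "1 \<le> y" | "y \<le> 1" "1 \<le> z" by linarith
  thus ?thesis
  proof cases
    case 3
    thus ?thesis
      using potential_mono_le_1[OF a, of y 1] potential_ge_1[of 1 a] potential_ge_1[of z a] by simp
  qed (use assms potential_mono_le_1 in \<open>simp_all add: potential_ge_1\<close>)
qed

lemma potential_lipschitz:
  assumes a: "0 \<le> a" "a \<le> 1" and y: "y \<le> z"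
  shows "potential a z \<le> potential a y + (z - y)"
proof -
  consider "z \<le> 1" | "1 \<le> y" | "y \<le> 1" "1 \<le> z" by linarith
  thus ?thesis
  proof cases
    case 3
    thus ?thesis
      using potential_lipschitz_le_1[OF a, of y 1] potential_ge_1[of 1 a] potential_ge_1[of z a]
      by simp
  qed (use assms potential_lipschitz_le_1 in \<open>simp_all add: potential_ge_1\<close>)
qed

lemma exp_mult_one_minus_le: "exp t * (1 - t) \<le> (1::real)"
proof -
  have "exp t * (1 - t) \<le> exp t * exp (- t)"
    using exp_ge_add_one_self[of "- t"] by (intro mult_left_mono) auto
  thus ?thesis
    by (simp flip: exp_add)
qed

lemma exp_mult_two_minus_le:
  assumes "0 \<le> (t::real)"
  shows "exp t * (2 - t) \<le> 2 + t"
proof -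
  have "2 + 0 - exp 0 * (2 - 0) \<le> 2 + t - exp t * (2 - t)"
  proof (rule DERIV_nonneg_imp_nondecreasing[OF assms])
    fix x :: real assume "0 \<le> x"
    have "((\<lambda>t. 2 + t - exp t * (2 - t)) has_real_derivative 1 - exp x * (1 - x)) (at x)"
      by (auto intro!: derivative_eq_intros simp: algebra_simps)
    thus "\<exists>d. ((\<lambda>t. 2 + t - exp t * (2 - t)) has_real_derivative d) (at x) \<and> 0 \<le> d"
      using exp_mult_one_minus_le[of x] by (intro exI conjI) auto
  qed
  thus ?thesis by simp
qed

section \<open>The effect of one insertion on the potential\<close>

text \<open>
  \<open>K\<close> is the overflow probability of an insertion and \<open>r\<close> the mean size conditional on fitting.
\<close>

lemma potential_superharmonic:
  assumes a: "a \<le> 1" and r: "0 \<le> r" "r \<le> a" and K: "0 \<le> K" "K \<le> 1"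
  shows "(1 - K) * potential (a - r) (y + ((1 - K) * r + K)) \<le> potential a y"
proof -
  define m where "m = (1 - K) * r + K"
  have r1: "(1 - K) * r = m - K" by (simp add: m_def)
  have "0 \<le> (1 - K) * r" using r K by simp
  hence m: "0 \<le> m" "K \<le> m" using K by (auto simp: m_def)
  have a0: "0 \<le> a" using r by simp
  \<comment> \<open>The cases record on which side of the kink at 1 the arguments \<open>y\<close>
    and \<open>y + m\<close> lie.\<close>
  consider (lin) "1 \<le> y" | (mid) "y \<le> 1" "1 \<le> y + m" | (exp) "y + m \<le> 1" by linarith
  hence "(1 - K) * potential (a - r) (y + m) \<le> potential a y"
  proof cases
    case lin
    have "(1 - K) * (y + m + (a - r)) = y + a - (K * (y - 1) + K * m + K * a)"
      using r1 by (simp add: algebra_simps)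
    also have "\<dots> \<le> y + a"
    proof -
      have "0 \<le> K * (y - 1)" "0 \<le> K * m" "0 \<le> K * a" using lin K m a0 by auto
      thus ?thesis by linarith
    qed
    finally show ?thesis
      using lin m by (simp add: potential_ge_1 algebra_simps)
  next
    case mid
    define t where "t = 1 - y"
    have t: "0 \<le> t" using mid by (simp add: t_def)
    have "(1 - K) * (y + m + (a - r)) = y + a - K * (y + m - 1) - K * a"
      using r1 by (simp add: algebra_simps)
    also have "\<dots> \<le> y + a"
    proof -
      have "0 \<le> K * (y + m - 1)" "0 \<le> K * a" using mid K a0 by auto
      thus ?thesis by linarith
    qed
    \<comment> \<open>Both \<open>y + a\<close> and \<open>potential a y\<close> are affine in
      \<open>a\<close>, so it suffices to compare them at \<open>a = 0\<close> and
      \<open>a = 1\<close>.\<close>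
    also have "y + a = (1 - a) * (1 - t) + a * (2 - t)"
      by (simp add: t_def algebra_simps)
    also have "\<dots> \<le> (1 - a) * exp (- t) + a * (exp (- t) * (2 + t))"
    proof (intro add_mono mult_left_mono)
      show "1 - t \<le> exp (- t)" using exp_ge_add_one_self[of "- t"] by simp
      have "exp (- t) * (exp t * (2 - t)) \<le> exp (- t) * (2 + t)"
        using exp_mult_two_minus_le[OF t] by (intro mult_left_mono) auto
      thus "2 - t \<le> exp (- t) * (2 + t)"
        by (simp add: mult.assoc[symmetric] flip: exp_add)
    qed (use a a0 in auto)
    also have "\<dots> = potential a y"
      using mid by (simp add: potential_le_1 t_def algebra_simps)
    finally show ?thesis
      using mid by (simp add: potential_ge_1 algebra_simps)
  next
    case exp
    define u where "u = 2 - y - m"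
    have u: "1 \<le> u" using exp by (simp add: u_def)
    \<comment> \<open>After division by \<open>exp (y - 1)\<close> the claim becomes
      \<open>main\<close> below, whose two sides are affine in \<open>u \<ge> 1\<close>. The slopes
      in \<open>u\<close> are compared here, the values at \<open>u = 1\<close> in the next
      block.\<close>
    have "exp m * ((1 - K) * a - (m - K)) \<le> exp m * (a * (1 - m))"
      using mult_nonneg_nonneg[of "m - K" "1 - a"] m a
      by (intro mult_left_mono) (auto simp: algebra_simps)
    also have "\<dots> = a * (exp m * (1 - m))" by simp
    also have "\<dots> \<le> a * 1"
      using exp_mult_one_minus_le[of m] a0 by (intro mult_left_mono) auto
    finally have "(u - 1) * (exp m * ((1 - K) * a - (m - K))) \<le> (u - 1) * a"
      using u by (intro mult_left_mono) auto
    moreover have "exp m * (1 + a - K * a - m) \<le> 1 + a + a * m"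
    proof -
      have "exp m * (1 + a - K * a - m) \<le> exp m * (1 + a - m)"
        using K a0 by (intro mult_left_mono) auto
      also have "\<dots> = (1 - a) * (exp m * (1 - m)) + a * (exp m * (2 - m))"
        by (simp add: algebra_simps)
      also have "\<dots> \<le> (1 - a) * 1 + a * (2 + m)"
        using exp_mult_one_minus_le[of m] exp_mult_two_minus_le[OF m(1)] a a0
        by (intro add_mono mult_left_mono) auto
      finally show ?thesis by (simp add: algebra_simps)
    qed
    ultimately have main: "exp m * ((1 - K) * (1 + a * u) - (m - K) * u) \<le> 1 + a * (u + m)"
      by (simp add: algebra_simps)
    have split: "exp (y + m - 1) = exp (y - 1) * exp m"
      by (simp add: algebra_simps flip: exp_add)
    have "(1 - K) * potential (a - r) (y + m)
            = exp (y - 1) * (exp m * ((1 - K) * (1 + a * u) - (1 - K) * r * u))"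
      using exp by (simp add: potential_le_1 u_def split) (simp add: algebra_simps)
    also have "\<dots> \<le> exp (y - 1) * (1 + a * (u + m))"
      unfolding r1 by (intro mult_left_mono main) auto
    also have "\<dots> = potential a y"
      using exp m by (simp add: potential_le_1 u_def)
    finally show ?thesis .
  qed
  thus ?thesis by (simp add: m_def)
qed

text \<open>Intended reading for an item of size S: \<open>q = P(S > 1)\<close>,
  \<open>K = P(S > a)\<close>, \<open>mu = E min(S, 1)\<close>, and \<open>e\<close> is the mean of
  S restricted to the event \<open>S \<le> a\<close>. Gaining \<open>v\<close> and giving up the
  bonus raises the argument of the potential by at most \<open>mu + v * q / lam\<close>. The part
  \<open>mu \<le> e + K\<close> is covered by \<open>potential_superharmonic\<close>. By the
  Lipschitz bound the rest costs at most \<open>(1 - K) * (v * q) \<le> K * W\<close>, which is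
  exactly what the summand \<open>W\<close> loses when overflow has probability
  \<open>K\<close>.\<close>

lemma potential_insertion:
  fixes y :: real
  assumes lam: "0 < lam" and a: "0 \<le> a" "a \<le> 1" and K: "q \<le> K" "0 \<le> q" "K \<le> 1"
    and e: "0 \<le> e" "e \<le> a * (1 - K)" and mu: "mu \<le> e + K"
    and v: "0 \<le> v" "v * (1 - q) \<le> W"
  defines "z \<equiv> (y + v - max 0 (v * (1 - q) - lam * mu)) / lam"
  shows "(1 - K) * (W + lam * potential a z) - lam * spare_potential z * e
           \<le> W + lam * potential a (y / lam)"
proof (cases "K = 1")
  case True
  have "0 \<le> v * (1 - q)" using v K by simp
  moreover have "0 \<le> a" using a by simp
  ultimately show ?thesis using e True potential_nonneg[of a "y / lam"] v lam by simp
next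
  case False
  hence K1: "K < 1" using K by simp
  define r where "r = e / (1 - K)"
  have er: "e = (1 - K) * r" using K1 by (simp add: r_def)
  have r: "0 \<le> r" "r \<le> a" using e K1 by (auto simp: r_def field_simps)
  define y1 where "y1 = y / lam + ((1 - K) * r + K)"
  define d where "d = v * q / lam"
  have d: "0 \<le> d" using v K lam by (simp add: d_def)
  have "v - max 0 (v * (1 - q) - lam * mu) \<le> v * q + lam * mu"
    by (simp add: algebra_simps max_def)
  also have "lam * mu \<le> lam * (e + K)"
    using lam mu by simp
  finally have "y + v - max 0 (v * (1 - q) - lam * mu) \<le> (y1 + d) * lam"
    using lam by (simp add: y1_def d_def er algebra_simps)
  hence z: "z \<le> y1 + d"
    using lam by (simp add: z_def pos_divide_le_eq)
  have "potential (a - r) z \<le> potential (a - r) (y1 + d)"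
    using r a z by (intro potential_mono) auto
  also have "\<dots> \<le> potential (a - r) y1 + (y1 + d - y1)"
    using r a d by (intro potential_lipschitz) auto
  finally have "(1 - K) * potential (a - r) z \<le> (1 - K) * (potential (a - r) y1 + d)"
    using K1 by (intro mult_left_mono) auto
  also have "\<dots> = (1 - K) * potential (a - r) y1 + (1 - K) * d"
    by (simp add: algebra_simps)
  also have "(1 - K) * potential (a - r) y1 \<le> potential a (y / lam)"
    unfolding y1_def using K r a by (intro potential_superharmonic) auto
  finally have "lam * ((1 - K) * potential (a - r) z) \<le> lam * (potential a (y / lam) + (1 - K) * d)"
    using lam by (intro mult_left_mono) auto
  also have "\<dots> = lam * potential a (y / lam) + (1 - K) * (v * q)"
    using lam by (simp add: d_def field_simps)
  also have "(1 - K) * (v * q) \<le> (1 - q) * (v * q)"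
    using K v by (intro mult_right_mono) auto
  also have "\<dots> = q * (v * (1 - q))" by simp
  also have "\<dots> \<le> K * W"
    using K v by (intro mult_mono) auto
  finally show ?thesis
    by (simp add: potential_def er algebra_simps)
qed

text \<open>Since \<open>potential\<close> is affine in the spare capacity, only the mass and the
  partial mean of the size on \<open>{0..a}\<close> enter the integral. This reduces the average
  over the size to \<open>potential_insertion\<close>.\<close>

lemma (in real_distribution) insertion_bound:
  fixes y :: real
  assumes nonneg: "AE x in M. 0 \<le> x"
    and lam: "0 < lam" and a: "0 \<le> a" "a \<le> 1"
    and v: "0 \<le> v" "v * prob {..1} \<le> W"
  defines "z \<equiv> (y + v - max 0 (v * prob {..1} - lam * (\<integral>x. min x 1 \<partial>M))) / lam"
  shows "(\<integral>\<^sup>+x. ennreal (if x \<le> a then W + lam * potential (a - x) z else 0) \<partial>M)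
           \<le> ennreal (W + lam * potential a (y / lam))"
proof -
  define K where "K = prob {a<..}"
  define q where "q = prob {1<..}"
  define e where "e = (\<integral>x. x * indicator {0..a} x \<partial>M)"
  have W: "0 \<le> W"
    using v by (meson measure_nonneg mult_nonneg_nonneg order_trans)
  have prob_atMost: "prob {..b} = 1 - prob {b<..}" for b
  proof -
    have "{..b} = space M - {b<..}" by auto
    thus ?thesis by (simp only: prob_compl sets.sets_into_space events_eq_borel borel_open open_greaterThan)
  qed
  have prob_Icc: "prob {0..a} = 1 - K"
  proof -
    have "prob {0..a} = prob {..a}"
      using nonneg by (intro measure_eq_AE) auto
    thus ?thesis by (simp add: prob_atMost K_def)
  qed
  have int_indicator: "integrable M (indicator B :: real \<Rightarrow> real)" if "B \<in> sets borel" for B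
    using that by (intro integrable_real_indicator) (auto simp: emeasure_eq_measure)
  have int_x: "integrable M (\<lambda>x. x * indicator {0..a} x)"
    by (rule integrable_const_bound[where B = a]) (use a in \<open>auto simp: indicator_def\<close>)
  have int_min: "integrable M (\<lambda>x. min x 1)"
    by (rule integrable_const_bound[where B = 1]) (use nonneg in \<open>auto simp: min_def\<close>)
  have "q \<le> K"
    unfolding q_def K_def using a by (intro finite_measure_mono) auto
  moreover have "0 \<le> e"
    unfolding e_def by (intro integral_nonneg_AE) (auto simp: indicator_def)
  moreover have "e \<le> (\<integral>x. a * indicator {0..a} x \<partial>M)"
    unfolding e_def
    by (intro integral_mono int_x integrable_mult_right int_indicator) (auto simp: indicator_def)
  moreover have "(\<integral>x. a * indicator {0..a} x \<partial>M) = a * (1 - K)"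
    using prob_Icc by (simp only: integral_mult_right_zero Bochner_Integration.integral_indicator
      space_eq_univ Int_UNIV_right)
  moreover have "(\<integral>x. min x 1 \<partial>M) \<le> e + K"
  proof -
    \<comment> \<open>Sizes that fit are counted in full; a size that does not fit is truncated to
      at most 1.\<close>
    have "(\<integral>x. min x 1 \<partial>M) \<le> (\<integral>x. x * indicator {0..a} x + indicator {a<..} x \<partial>M)"
      using nonneg
      by (intro integral_mono_AE int_min Bochner_Integration.integrable_add int_x
          int_indicator)
        (auto simp: indicator_def)
    also have "\<dots> = e + K"
      by (subst Bochner_Integration.integral_add)
        (auto simp: int_x e_def K_def int_indicator)
    finally show ?thesis .
  qed
  ultimately have step: "(1 - K) * (W + lam * potential a z) - lam * spare_potential z * e
      \<le> W + lam * potential a (y / lam)"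
    unfolding z_def prob_atMost q_def[symmetric]
    using lam a v by (intro potential_insertion) (auto simp: K_def q_def prob_atMost)
  define f where "f = (\<lambda>x. indicator {0..a} x * (W + lam * potential a z)
                            - lam * spare_potential z * (x * indicator {0..a} x))"
  have f: "f x = indicator {0..a} x * (W + lam * potential (a - x) z)" for x
    by (simp add: f_def potential_def algebra_simps)
  have int_f: "integrable M f"
    unfolding f_def
    by (intro Bochner_Integration.integrable_diff integrable_mult_right int_x
          integrable_mult_left int_indicator) auto
  have "(\<integral>\<^sup>+x. ennreal (if x \<le> a then W + lam * potential (a - x) z else 0) \<partial>M)
          = (\<integral>\<^sup>+x. ennreal (f x) \<partial>M)"
    using nonneg by (intro nn_integral_cong_AE) (auto simp: f indicator_def)
  also have "\<dots> = ennreal (\<integral>x. f x \<partial>M)"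
    using lam W by (intro nn_integral_eq_integral int_f)
      (auto simp: f indicator_def intro!: AE_I2 add_nonneg_nonneg mult_nonneg_nonneg potential_nonneg)
  also have "(\<integral>x. f x \<partial>M) = (1 - K) * (W + lam * potential a z) - lam * spare_potential z * e"
    unfolding f_def e_def
    by (subst Bochner_Integration.integral_diff) (auto simp: int_x int_indicator prob_Icc)
  finally show ?thesis
    using step by (metis ennreal_leI)
qed

section \<open>Upper bound for arbitrary policies\<close>

text \<open>Generalises \<open>risky_payoff\<close> to a run that starts with used capacity
  \<open>x\<close> and collected value \<open>V\<close>, the form in which an induction over the
  decision tree goes through.\<close>

definition payoff_from :: "(nat \<Rightarrow> real) \<Rightarrow> policy \<Rightarrow> (nat \<Rightarrow> real) \<Rightarrow> real \<Rightarrow> real \<Rightarrow> real" where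
  "payoff_from v p s x V =
     (let L = inserted s p x in if x + sum_list (map s L) > 1 then 0 else V + sum_list (map v L))"

lemma risky_payoff_conv_payoff_from: "risky_payoff I p s = payoff_from (item_value I) p s 0 0"
  by (simp add: risky_payoff_def payoff_from_def Let_def)

lemma payoff_from_Stop: "x \<le> 1 \<Longrightarrow> payoff_from v Stop s x V = V"
  by (simp add: payoff_from_def)

lemma payoff_from_Insert:
  "payoff_from v (Insert i p) s x V
     = (if x + s i > 1 then 0 else payoff_from v p s (x + s i) (V + v i))"
  by (simp add: payoff_from_def Let_def add.assoc)

lemma payoff_from_Query: "payoff_from v (Query f) s x V = payoff_from v (f x) s x V"
  by (simp add: payoff_from_def)

text \<open>Once an item is inserted, the continuation no longer reads its size; this lets that
  coordinate be split off from the product measure.\<close>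

lemma inserted_cong:
  "semi_adaptive p A k \<Longrightarrow> (\<And>i. i \<in> A \<Longrightarrow> s i = t i) \<Longrightarrow> inserted s p x = inserted t p x"
proof (induction p arbitrary: A k x)
  case (Insert i p)
  thus ?case by (auto dest!: Insert.IH[of "A - {i}" k "x + t i"])
next
  case (Query f)
  thus ?case by (auto intro!: Query.IH[of _ A "k - 1"])
qed auto

lemma set_inserted_subset: "semi_adaptive p A k \<Longrightarrow> set (inserted s p x) \<subseteq> A"
proof (induction p arbitrary: A k x)
  case (Insert i p)
  thus ?case using Insert.IH[of "A - {i}" k "x + s i"] by auto
next
  case (Query f)
  thus ?case using Query.IH[of "f x" A "k - 1" x] by auto
qed auto

lemma payoff_from_cong:
  assumes "semi_adaptive p A k" and st: "\<And>i. i \<in> A \<Longrightarrow> s i = t i"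
  shows "payoff_from v p s x V = payoff_from v p t x V"
proof -
  have "inserted s p x = inserted t p x"
    using assms by (rule inserted_cong)
  moreover have "map s (inserted t p x) = map t (inserted t p x)"
    using set_inserted_subset[OF assms(1), of t x] st by auto
  ultimately show ?thesis
    by (simp only: payoff_from_def Let_def)
qed

lemma measurable_PiM_coordinate:
  assumes "\<And>i. i \<in> A \<Longrightarrow> sets (M i) = sets borel"
  shows "(\<lambda>s. s i) \<in> measurable (PiM A M) (borel :: real measure)"
proof (cases "i \<in> A")
  case True
  hence "(\<lambda>s. s i) \<in> measurable (PiM A M) (M i)" by simp
  thus ?thesis using assms[OF True] measurable_cong_sets by blast
next
  case False
  hence "s i = undefined" if "s \<in> space (PiM A M)" for s
    using that by (auto simp: space_PiM PiE_def extensional_def)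
  thus ?thesis
    by (subst measurable_cong[where g = "\<lambda>_. undefined"]) auto
qed

lemma measurable_sum_list_map:
  fixes f :: "'a \<Rightarrow> 'b \<Rightarrow> real"
  assumes "\<And>i. f i \<in> borel_measurable N"
  shows "(\<lambda>s. sum_list (map (\<lambda>i. f i s) L)) \<in> borel_measurable N"
  using assms by (induction L) auto

text \<open>The executed list ranges over a countable type, and for each fixed list the payoff is a
  measurable function of the sizes.\<close>

lemma measurable_payoff_from:
  assumes M: "\<And>i. sets (M i) = sets borel"
    and p: "(\<lambda>s. inserted s p x) \<in> measurable (PiM A M) (count_space UNIV)"
  shows "(\<lambda>s. payoff_from v p s x V) \<in> borel_measurable (PiM A M)"
proof -
  have [measurable]: "(\<lambda>s. sum_list (map s L)) \<in> borel_measurable (PiM A M)" for L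
    by (rule measurable_sum_list_map) (rule measurable_PiM_coordinate[OF M])
  show ?thesis
    unfolding payoff_from_def Let_def
    by (rule measurable_compose_countable[OF _ p,
          where f = "\<lambda>L s. if x + sum_list (map s L) > 1 then 0 else V + sum_list (map v L)"]) simp
qed

text \<open>Induction on the decision tree. \<open>Stop\<close> is \<open>potential_ge\<close>. A
  query changes neither the state nor the bound, so \<open>k\<close> does not occur in the
  conclusion. For an insertion, Fubini splits off the size of the item, the induction hypothesis
  bounds the continuation for each size that fits, and \<open>insertion_bound\<close>
  averages.\<close>

lemma policy_payoff_bound:
  fixes M :: "nat \<Rightarrow> real measure" and v :: "nat \<Rightarrow> real" and lam W :: real
  assumes distr: "\<And>i. real_distribution (M i)" and lam: "0 < lam" and W: "0 \<le> W"
  defines "bonus \<equiv> \<lambda>i. max 0 (v i * measure (M i) {..1} - lam * (\<integral>x. min x 1 \<partial>M i))"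
  assumes "finite A" "semi_adaptive p A k"
    and "(\<lambda>s. inserted s p x) \<in> measurable (PiM A M) (count_space UNIV)"
    and "0 \<le> x" "x \<le> 1"
    and "\<And>i. i \<in> A \<Longrightarrow> (AE y in M i. 0 \<le> y) \<and> 0 \<le> v i \<and> v i * measure (M i) {..1} \<le> W"
  shows "(\<integral>\<^sup>+s. ennreal (payoff_from v p s x V) \<partial>PiM A M)
           \<le> ennreal (W + lam * potential (1 - x) ((V + (\<Sum>i\<in>A. bonus i)) / lam))"
  using assms(5-)
proof (induction p arbitrary: A k x V)
  case Stop
  interpret P: prob_space "PiM A M"
    by (rule prob_space_PiM) (use distr in \<open>auto simp: real_distribution_def\<close>)
  have "V \<le> lam * ((V + (\<Sum>i\<in>A. bonus i)) / lam)"
    using lam by (simp add: bonus_def sum_nonneg)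
  also have "\<dots> \<le> lam * potential (1 - x) ((V + (\<Sum>i\<in>A. bonus i)) / lam)"
    using lam Stop by (intro mult_left_mono potential_ge) auto
  finally show ?case
    using Stop W by (simp add: payoff_from_Stop P.emeasure_space_1 ennreal_leI)
next
  case (Query f)
  thus ?case
    unfolding payoff_from_Query by (intro Query.IH[of "f x" A "k - 1"]) auto
next
  case (Insert i p)
  interpret product_prob_space M
    by (intro product_prob_spaceI) (use distr in \<open>auto simp: real_distribution_def\<close>)
  interpret Mi: real_distribution "M i" by (rule distr)
  define A' where "A' = A - {i}"
  have A: "A = insert i A'" "i \<notin> A'" "finite A'" and p: "semi_adaptive p A' k"
    using Insert.prems by (auto simp: A'_def)
  have i: "(AE y in M i. 0 \<le> y) \<and> 0 \<le> v i \<and> v i * measure (M i) {..1} \<le> W"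
    using Insert.prems(2) by (intro Insert.prems(6)) simp
  have M: "sets (M j) = sets borel" for j
    using distr[of j] by (simp add: real_distribution.events_eq_borel)
  define z where "z = (V + (\<Sum>i\<in>A. bonus i) + v i - bonus i) / lam"
  have z: "(V + v i + (\<Sum>i\<in>A'. bonus i)) / lam = z"
    using A by (simp add: z_def)
  have inner: "(\<integral>\<^sup>+s. ennreal (payoff_from v (Insert i p) (s(i := y)) x V) \<partial>PiM A' M)
      \<le> ennreal (if y \<le> 1 - x then W + lam * potential (1 - x - y) z else 0)" if y: "0 \<le> y" for y
  proof (cases "y \<le> 1 - x")
    case True
    have upd: "(\<lambda>s. s(i := y)) \<in> measurable (PiM A' M) (PiM A M)"
      unfolding A(1) by (rule measurable_fun_upd[where J = A']) (use M in \<open>auto simp: sets_eq_imp_space_eq[OF M]\<close>)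
    \<comment> \<open>Measurability is given only for the list of the whole run. As the item fits,
      that list starts with \<open>i\<close>, and \<open>tl\<close> leaves the list of the
      continuation.\<close>
    have "(\<lambda>s. tl (inserted (s(i := y)) (Insert i p) x)) \<in> measurable (PiM A' M) (count_space UNIV)"
      using measurable_compose[OF upd Insert.prems(3)] by (rule measurable_compose) auto
    also have "(\<lambda>s. tl (inserted (s(i := y)) (Insert i p) x)) = (\<lambda>s. inserted s p (x + y))"
    proof
      fix s
      show "tl (inserted (s(i := y)) (Insert i p) x) = inserted s p (x + y)"
        using True A(2) inserted_cong[OF p, of "s(i := y)" s "x + y"] by fastforce
    qed
    finally have meas: "(\<lambda>s. inserted s p (x + y)) \<in> measurable (PiM A' M) (count_space UNIV)" .
    have "payoff_from v (Insert i p) (s(i := y)) x V = payoff_from v p s (x + y) (V + v i)" for s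
      using True A(2) payoff_from_cong[OF p, of "s(i := y)" s v "x + y"]
      by (fastforce simp: payoff_from_Insert)
    hence "(\<integral>\<^sup>+s. ennreal (payoff_from v (Insert i p) (s(i := y)) x V) \<partial>PiM A' M)
             = (\<integral>\<^sup>+s. ennreal (payoff_from v p s (x + y) (V + v i)) \<partial>PiM A' M)"
      by simp
    also have "\<dots> \<le> ennreal (W + lam * potential (1 - (x + y)) z)"
      unfolding z[symmetric]
    proof (rule Insert.IH[OF A(3) p meas])
      show "0 \<le> x + y" "x + y \<le> 1" using Insert.prems(4) True y by simp_all
      show "(AE y in M j. 0 \<le> y) \<and> 0 \<le> v j \<and> v j * measure (M j) {..1} \<le> W" if "j \<in> A'" for j
        using that by (intro Insert.prems(6)) (simp add: A'_def)
    qed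
    finally show ?thesis using True by (simp add: algebra_simps)
  qed (simp add: payoff_from_Insert)
  have "(\<integral>\<^sup>+s. ennreal (payoff_from v (Insert i p) s x V) \<partial>PiM A M)
          = (\<integral>\<^sup>+y. (\<integral>\<^sup>+s. ennreal (payoff_from v (Insert i p) (s(i := y)) x V) \<partial>PiM A' M) \<partial>M i)"
    unfolding A(1)
  proof (rule product_nn_integral_insert_rev[OF A(3,2)])
    show "(\<lambda>s. ennreal (payoff_from v (Insert i p) s x V)) \<in> borel_measurable (PiM (insert i A') M)"
      using measurable_payoff_from[OF M Insert.prems(3)] unfolding A(1)
      by (rule measurable_compose) simp
  qed
  also have "\<dots> \<le> (\<integral>\<^sup>+y. ennreal (if y \<le> 1 - x then W + lam * potential (1 - x - y) z else 0) \<partial>M i)"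
  proof (rule nn_integral_mono_AE)
    have "AE y in M i. 0 \<le> y" using i by simp
    thus "AE y in M i. (\<integral>\<^sup>+s. ennreal (payoff_from v (Insert i p) (s(i := y)) x V) \<partial>PiM A' M)
      \<le> ennreal (if y \<le> 1 - x then W + lam * potential (1 - x - y) z else 0)"
      by (rule AE_mp) (use inner in auto)
  qed
  also have "\<dots> \<le> ennreal (W + lam * potential (1 - x) ((V + (\<Sum>i\<in>A. bonus i)) / lam))"
  proof -
    have "bonus i = max 0 (v i * measure (M i) {..1} - lam * (\<integral>x. min x 1 \<partial>M i))"
      by (simp only: bonus_def)
    thus ?thesis
      using Mi.insertion_bound[of lam "1 - x" "v i" W "V + (\<Sum>i\<in>A. bonus i)"]
        i lam Insert.prems(4,5) by (simp only: z_def)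
  qed
  finally show ?case .
qed

section \<open>Lower bounds from non-adaptive policies\<close>

lemma semi_adaptive_foldr_Insert:
  "distinct xs \<Longrightarrow> set xs \<subseteq> A \<Longrightarrow> semi_adaptive (foldr Insert xs Stop) A k"
proof (induction xs arbitrary: A)
  case (Cons i xs)
  have "semi_adaptive (foldr Insert xs Stop) (A - {i}) k"
    using Cons.prems by (intro Cons.IH) auto
  thus ?case using Cons.prems by simp
qed simp

lemma inserted_foldr_Insert:
  "(\<And>i. i \<in> set xs \<Longrightarrow> 0 \<le> s i) \<Longrightarrow> x + sum_list (map s xs) \<le> 1 \<Longrightarrow>
     inserted s (foldr Insert xs Stop) x = xs"
proof (induction xs arbitrary: x)
  case (Cons i xs)
  have "0 \<le> sum_list (map s xs)"
    using Cons.prems by (intro sum_list_nonneg) auto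
  thus ?case using Cons by (auto simp: add.assoc)
qed simp

text \<open>The start \<open>X\<close> is a random variable because the used capacity after the
  first insertion depends on the sizes.\<close>

lemma measurable_inserted_foldr_Insert:
  fixes N :: "(nat \<Rightarrow> real) measure"
  assumes "\<And>i. (\<lambda>s. s i) \<in> borel_measurable N" "X \<in> borel_measurable N"
  shows "(\<lambda>s. inserted s (foldr Insert xs Stop) (X s)) \<in> measurable N (count_space UNIV)"
  using assms(2)
proof (induction xs arbitrary: X)
  case (Cons i xs)
  note [measurable] = assms(1) Cons.prems
  have [measurable]: "(\<lambda>s. inserted s (foldr Insert xs Stop) (X s + s i)) \<in> measurable N (count_space UNIV)"
    by (rule Cons.IH) simp
  have "(\<lambda>s. if X s + s i > 1 then [] else inserted s (foldr Insert xs Stop) (X s + s i))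
          \<in> measurable N (count_space UNIV)"
    by measurable
  hence "(\<lambda>s. i # (if X s + s i > 1 then [] else inserted s (foldr Insert xs Stop) (X s + s i)))
          \<in> measurable N (count_space UNIV)"
    by (rule measurable_compose) simp
  thus ?case by simp
qed simp

lemma knapsack_instanceD:
  assumes "knapsack_instance I" "i < item_count I"
  shows "0 \<le> item_value I i" "real_distribution (size_distr I i)" "prob_space (size_distr I i)"
    "sets (size_distr I i) = sets borel" "AE x in size_distr I i. 0 \<le> x"
  using assms by (auto simp: knapsack_instance_def real_distribution_def real_distribution_axioms_def)

lemma prob_space_sizes_space: "knapsack_instance I \<Longrightarrow> prob_space (sizes_space I)"
  unfolding sizes_space_def by (rule prob_space_PiM) (auto dest: knapsack_instanceD)

lemma measurable_sizes_space_coordinate: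
  "knapsack_instance I \<Longrightarrow> (\<lambda>s. s i) \<in> borel_measurable (sizes_space I)"
  unfolding sizes_space_def by (rule measurable_PiM_coordinate) (auto dest: knapsack_instanceD)

lemma distr_sizes_space_coordinate:
  assumes "knapsack_instance I" "i < item_count I"
  shows "distr (sizes_space I) (size_distr I i) (\<lambda>s. s i) = size_distr I i"
  unfolding sizes_space_def using assms by (intro distr_PiM_component) (auto dest: knapsack_instanceD)

lemma AE_sizes_space_nonneg:
  assumes I: "knapsack_instance I" and A: "A \<subseteq> {..<item_count I}"
  shows "AE s in sizes_space I. \<forall>i\<in>A. 0 \<le> s i"
proof (rule AE_finite_allI)
  show "finite A" using A finite_subset by blast
  fix i assume "i \<in> A"
  thus "AE s in sizes_space I. 0 \<le> s i"
    unfolding sizes_space_def using I A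
    by (intro AE_PiM_component) (auto dest: knapsack_instanceD)
qed

text \<open>Insert \<open>A\<close> in increasing order without queries: if the sizes sum to at most
  1, the whole value is collected. This policy is admissible for every \<open>k\<close>, including
  0.\<close>

lemma risky_opt_ge_fixed_set:
  assumes I: "knapsack_instance I" and A: "A \<subseteq> {..<item_count I}"
  shows "ennreal ((\<Sum>i\<in>A. item_value I i)
           * measure (sizes_space I) {s \<in> space (sizes_space I). (\<Sum>i\<in>A. s i) \<le> 1}) \<le> risky_opt k I"
proof -
  interpret prob_space "sizes_space I" by (rule prob_space_sizes_space[OF I])
  note [measurable] = measurable_sizes_space_coordinate[OF I]
  define xs where "xs = sorted_list_of_set A"
  define E where "E = {s \<in> space (sizes_space I). (\<Sum>i\<in>A. s i) \<le> 1}"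
  have [measurable]: "E \<in> sets (sizes_space I)" unfolding E_def by measurable
  have "finite A" using A finite_subset by blast
  hence xs: "distinct xs" "set xs = A" by (simp_all add: xs_def)
  have sum_xs: "sum_list (map f xs) = sum f A" for f :: "nat \<Rightarrow> real"
    using xs by (simp add: sum_list_distinct_conv_sum_set)
  have v: "0 \<le> (\<Sum>i\<in>A. item_value I i)"
    using I A by (intro sum_nonneg) (auto dest: knapsack_instanceD)
  define p where "p = foldr Insert xs Stop"
  have "(\<lambda>s. inserted s p 0) \<in> measurable (sizes_space I) (count_space UNIV)"
    unfolding p_def
    by (rule measurable_inserted_foldr_Insert) (simp_all add: measurable_sizes_space_coordinate[OF I])
  hence "p \<in> policies I k"
    unfolding policies_def p_def using xs A by (auto intro!: semi_adaptive_foldr_Insert)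
  moreover have "ennreal ((\<Sum>i\<in>A. item_value I i) * prob E)
      \<le> (\<integral>\<^sup>+ s. ennreal (risky_payoff I p s) \<partial>sizes_space I)"
  proof -
    have "AE s in sizes_space I. ennreal (\<Sum>i\<in>A. item_value I i) * indicator E s
            \<le> ennreal (risky_payoff I p s)"
      using AE_sizes_space_nonneg[OF I A]
    proof eventually_elim
      case (elim s)
      show ?case
      proof (cases "s \<in> E")
        case True
        hence "inserted s p 0 = xs"
          unfolding p_def using elim xs by (intro inserted_foldr_Insert) (auto simp: sum_xs E_def)
        thus ?thesis using True by (simp add: risky_payoff_def sum_xs E_def)
      qed simp
    qed
    hence "(\<integral>\<^sup>+ s. ennreal (\<Sum>i\<in>A. item_value I i) * indicator E s \<partial>sizes_space I)
             \<le> (\<integral>\<^sup>+ s. ennreal (risky_payoff I p s) \<partial>sizes_space I)"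
      by (rule nn_integral_mono_AE)
    thus ?thesis
      using v by (simp add: nn_integral_cmult_indicator emeasure_eq_measure ennreal_mult)
  qed
  ultimately show ?thesis
    unfolding risky_opt_def E_def by (meson SUP_upper2)
qed

lemma one_le_sum_min_one:
  fixes s :: "'a \<Rightarrow> real"
  assumes "finite A" "\<And>i. i \<in> A \<Longrightarrow> 0 \<le> s i" "1 < sum s A"
  shows "1 \<le> (\<Sum>i\<in>A. min (s i) 1)"
proof (cases "\<exists>i\<in>A. 1 \<le> s i")
  case True
  then obtain i where i: "i \<in> A" "1 \<le> s i" by blast
  hence "1 = min (s i) 1" by simp
  also have "\<dots> \<le> (\<Sum>i\<in>A. min (s i) 1)"
    using assms i by (intro member_le_sum) auto
  finally show ?thesis .
next
  case False
  hence "(\<Sum>i\<in>A. min (s i) 1) = sum s A"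
    by (intro sum.cong) auto
  thus ?thesis using assms by simp
qed

text \<open>Markov's inequality for truncated sizes: almost surely, the indicator of overflow is at
  most \<open>\<Sum>i\<in>A. min (s i) 1\<close>.\<close>

lemma prob_fits_ge:
  assumes I: "knapsack_instance I" and A: "A \<subseteq> {..<item_count I}"
  shows "1 - (\<Sum>i\<in>A. \<integral>x. min x 1 \<partial>size_distr I i)
           \<le> measure (sizes_space I) {s \<in> space (sizes_space I). (\<Sum>i\<in>A. s i) \<le> 1}"
proof -
  interpret prob_space "sizes_space I" by (rule prob_space_sizes_space[OF I])
  note [measurable] = measurable_sizes_space_coordinate[OF I]
  have fin: "finite A" using A finite_subset by blast
  define E where "E = {s \<in> space (sizes_space I). (\<Sum>i\<in>A. s i) \<le> 1}"
  have E [measurable]: "E \<in> events" unfolding E_def by measurable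
  have int: "integrable (sizes_space I) (\<lambda>s. min (s i) 1)" if "i \<in> A" for i
    by (rule integrable_const_bound[where B = 1])
      (use AE_sizes_space_nonneg[OF I A] that in \<open>auto simp: min_def\<close>)
  have comp: "(\<integral>s. min (s i) 1 \<partial>sizes_space I) = (\<integral>x. min x 1 \<partial>size_distr I i)" if "i \<in> A" for i
  proof -
    have i: "i < item_count I" using A that by auto
    have "(\<integral>x. min x 1 \<partial>distr (sizes_space I) (size_distr I i) (\<lambda>s. s i))
            = (\<integral>s. min (s i) 1 \<partial>sizes_space I)"
      using measurable_sizes_space_coordinate[OF I, of i] knapsack_instanceD(4)[OF I i]
      by (intro integral_distr) (simp_all cong: measurable_cong_sets)
    thus ?thesis by (simp add: distr_sizes_space_coordinate[OF I i])
  qed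
  have "1 - prob E = (\<integral>s. indicator (space (sizes_space I) - E) s \<partial>sizes_space I)"
    using E by (simp add: prob_compl)
  also have "\<dots> \<le> (\<integral>s. (\<Sum>i\<in>A. min (s i) 1) \<partial>sizes_space I)"
  proof (rule integral_mono_AE)
    show "AE s in sizes_space I. indicator (space (sizes_space I) - E) s \<le> (\<Sum>i\<in>A. min (s i) 1)"
      using AE_sizes_space_nonneg[OF I A]
    proof eventually_elim
      case (elim s)
      hence "0 \<le> (\<Sum>i\<in>A. min (s i) 1)" by (intro sum_nonneg) auto
      thus ?case
        using elim one_le_sum_min_one[OF fin, of s] by (auto simp: indicator_def E_def)
    qed
  qed (use int in \<open>auto intro!: Bochner_Integration.integrable_sum integrable_real_indicator simp: emeasure_eq_measure\<close>)
  also have "\<dots> = (\<Sum>i\<in>A. \<integral>x. min x 1 \<partial>size_distr I i)"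
    using int by (subst Bochner_Integration.integral_sum) (auto simp: comp)
  finally show ?thesis by (simp add: E_def)
qed

lemma risky_opt_ge_single_item:
  assumes I: "knapsack_instance I" and i: "i < item_count I"
  shows "ennreal (item_value I i * measure (size_distr I i) {..1}) \<le> risky_opt k I"
proof -
  have "measure (size_distr I i) {..1}
          = measure (distr (sizes_space I) (size_distr I i) (\<lambda>s. s i)) {..1}"
    by (simp add: distr_sizes_space_coordinate[OF assms])
  also have "\<dots> = measure (sizes_space I) {s \<in> space (sizes_space I). s i \<le> 1}"
  proof (subst measure_distr)
    show "(\<lambda>s. s i) \<in> measurable (sizes_space I) (size_distr I i)"
      using measurable_sizes_space_coordinate[OF I, of i] knapsack_instanceD(4)[OF assms]
      by (simp cong: measurable_cong_sets)
    show "{..1} \<in> sets (size_distr I i)"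
      by (simp add: knapsack_instanceD(4)[OF assms])
  qed (intro arg_cong[where f = "measure (sizes_space I)"], blast)
  finally show ?thesis
    using risky_opt_ge_fixed_set[OF I, of "{i}" k] i by simp
qed

lemma risky_opt_ge_small_set:
  assumes I: "knapsack_instance I" and A: "A \<subseteq> {..<item_count I}"
  shows "ennreal ((\<Sum>i\<in>A. item_value I i * measure (size_distr I i) {..1})
           * (1 - (\<Sum>i\<in>A. \<integral>x. min x 1 \<partial>size_distr I i))) \<le> risky_opt k I"
proof -
  let ?m = "1 - (\<Sum>i\<in>A. \<integral>x. min x 1 \<partial>size_distr I i)"
  let ?P = "measure (sizes_space I) {s \<in> space (sizes_space I). (\<Sum>i\<in>A. s i) \<le> 1}"
  have v: "0 \<le> item_value I i * measure (size_distr I i) {..1}"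
    "item_value I i * measure (size_distr I i) {..1} \<le> item_value I i" if "i \<in> A" for i
    using A that knapsack_instanceD[OF I, of i]
    by (auto intro!: mult_left_le prob_space.prob_le_1)
  have "(\<Sum>i\<in>A. item_value I i * measure (size_distr I i) {..1}) * ?m
          \<le> (\<Sum>i\<in>A. item_value I i * measure (size_distr I i) {..1}) * ?P"
    using v by (intro mult_left_mono prob_fits_ge[OF I A] sum_nonneg)
  also have "\<dots> \<le> (\<Sum>i\<in>A. item_value I i) * ?P"
    using v by (intro mult_right_mono sum_mono) auto
  finally show ?thesis
    using risky_opt_ge_fixed_set[OF I A, of k] by (meson ennreal_leI order_trans)
qed

section \<open>A dual bound for the fractional knapsack\<close>

text \<open>
  The left-hand side is the dual objective of the fractional knapsack of capacity 1, so the lemma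
  bounds the fractional optimum by solutions of the two integral kinds. The multiplier is the density
  of the item at which the greedy filling exceeds capacity \<open>2 / 3\<close>.
\<close>

lemma fractional_knapsack_bound:
  fixes w mu :: "'a \<Rightarrow> real"
  assumes fin: "finite J" and w: "\<And>i. i \<in> J \<Longrightarrow> 0 \<le> w i" and mu: "\<And>i. i \<in> J \<Longrightarrow> 0 \<le> mu i"
    and L: "0 \<le> L" and single: "\<And>i. i \<in> J \<Longrightarrow> w i \<le> L"
    and small: "\<And>A. A \<subseteq> J \<Longrightarrow> sum w A * (1 - sum mu A) \<le> L"
  shows "\<exists>lam\<ge>0. (\<Sum>i\<in>J. max 0 (w i - lam * mu i)) + lam \<le> 9 / 2 * L"
proof -
  \<comment> \<open>Items with \<open>mu i = 0\<close> have density 0 by the convention for division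
    by zero. They are collected in \<open>Z\<close> and always packed first.\<close>
  define Z where "Z = {i \<in> J. mu i = 0}"
  define dens where "dens = (\<lambda>i. w i / mu i)"
  \<comment> \<open>\<open>P\<close> describes the initial segments of the greedy order with total
    weight at most \<open>2 / 3\<close>. A segment of maximal cardinality is chosen below.\<close>
  define P where "P = (\<lambda>A. Z \<subseteq> A \<and> A \<subseteq> J \<and> (\<forall>i\<in>A - Z. \<forall>j\<in>J - A. dens j \<le> dens i)
                         \<and> sum mu A \<le> 2 / 3)"
  have "P Z" by (auto simp: P_def Z_def)
  moreover have "\<forall>A. P A \<longrightarrow> card A < Suc (card J)"
    using fin by (auto simp: P_def less_Suc_eq_le intro: card_mono)
  ultimately obtain A where A: "P A" and max: "\<And>B. P B \<Longrightarrow> card B \<le> card A"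
    using ex_has_greatest_nat[of P Z card] by blast
  have finA: "finite A" and AJ: "A \<subseteq> J" using A fin finite_subset by (auto simp: P_def)
  define m where "m = sum mu A"
  have m: "0 \<le> m" "m \<le> 2 / 3"
    using A AJ mu by (auto simp: P_def m_def intro!: sum_nonneg)
  have wA: "0 \<le> sum w A" using AJ w by (intro sum_nonneg) auto
  have small_A: "sum w A * (1 - m) \<le> L" using small[OF AJ] by (simp add: m_def)
  show ?thesis
  proof (cases "A = J")
    case True
    \<comment> \<open>Everything is packed, so the multiplier 0 works, with the bound
      \<open>3 * L\<close>.\<close>
    have "sum w A * (1 / 3) \<le> sum w A * (1 - m)"
      using m wA by (intro mult_left_mono) auto
    moreover have "(\<Sum>i\<in>J. max 0 (w i - 0 * mu i)) = sum w A"
      using w True by (intro sum.cong) auto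
    ultimately show ?thesis
      using small_A L by (intro exI[of _ 0]) simp
  next
    case False
    hence "dens ` (J - A) \<noteq> {}" "finite (dens ` (J - A))" using AJ fin by auto
    hence "Max (dens ` (J - A)) \<in> dens ` (J - A)" by (intro Max_in)
    then obtain j where j: "j \<in> J" "j \<notin> A" and dens_j: "dens j = Max (dens ` (J - A))" by auto
    have le_dens_j: "dens i \<le> dens j" if "i \<in> J - A" for i
      unfolding dens_j using that fin by (intro Max_ge) auto
    have mu_pos: "0 < mu i" if "i \<in> J - A" for i
      using that mu[of i] A by (auto simp: P_def Z_def)
    define lam where "lam = dens j"
    have lam: "0 \<le> lam" using w mu j by (simp add: lam_def dens_def)
    have lam_j: "lam * mu j = w j" using mu_pos[of j] j by (simp add: lam_def dens_def)
    \<comment> \<open>\<open>j\<close> has maximal density outside \<open>A\<close>, so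
      \<open>insert j A\<close> is again an initial segment. By maximality of \<open>A\<close> it
      can only fail the weight limit.\<close>
    have "\<not> P (insert j A)"
      using max[of "insert j A"] j finA by auto
    hence big: "2 / 3 < m + mu j"
      using A j finA le_dens_j by (auto simp: P_def m_def)
    have in_A: "max 0 (w i - lam * mu i) = w i - lam * mu i" if "i \<in> A" for i
    proof (cases "i \<in> Z")
      case True
      thus ?thesis using w[of i] by (simp add: Z_def)
    next
      case False
      have "lam \<le> dens i" using A False that j by (auto simp: P_def lam_def)
      moreover have "0 < mu i" using False that AJ mu[of i] by (auto simp: Z_def order_le_less)
      ultimately show ?thesis by (simp add: dens_def field_simps)
    qed
    have notin_A: "max 0 (w i - lam * mu i) = 0" if "i \<in> J - A" for i
      using le_dens_j[OF that] mu_pos[OF that] by (simp add: dens_def lam_def field_simps)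
    have "(\<Sum>i\<in>J. max 0 (w i - lam * mu i)) = (\<Sum>i\<in>A. max 0 (w i - lam * mu i))"
      using notin_A AJ fin by (intro sum.mono_neutral_right) auto
    also have "\<dots> = sum w A - lam * m"
      by (simp add: in_A sum_subtractf sum_distrib_left m_def)
    finally have total: "(\<Sum>i\<in>J. max 0 (w i - lam * mu i)) = sum w A - lam * m" .
    have "0 \<le> (\<Sum>i\<in>J. max 0 (w i - lam * mu i))" by (intro sum_nonneg) auto
    hence lam_m: "lam * m \<le> sum w A" using total by simp
    have "sum w A + lam * (1 - m) \<le> 9 / 2 * L"
    proof (cases "1 / 3 \<le> m")
      case True
      \<comment> \<open>From \<open>lam * m \<le> sum w A\<close>, the dual objective is at most
        \<open>sum w A / m \<le> L / (m * (1 - m))\<close>, and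
        \<open>m * (1 - m) \<ge> 2 / 9\<close> on the interval from \<open>1 / 3\<close> to
        \<open>2 / 3\<close>.\<close>
      have "(sum w A + lam * (1 - m)) * m = sum w A * m + lam * m * (1 - m)"
        by (simp add: algebra_simps)
      also have "\<dots> \<le> sum w A * m + sum w A * (1 - m)"
        using lam_m m by (intro add_left_mono mult_right_mono) auto
      finally have "(sum w A + lam * (1 - m)) * m * (1 - m) \<le> sum w A * (1 - m)"
        using m by (intro mult_right_mono) (auto simp: algebra_simps)
      hence "(sum w A + lam * (1 - m)) * (m * (1 - m)) \<le> L"
        using small_A by (simp add: mult.assoc)
      moreover have "2 / 9 \<le> m * (1 - m)"
      proof -
        have "0 \<le> (m - 1 / 3) * (2 / 3 - m)" using True m by simp
        also have "\<dots> = m * (1 - m) - 2 / 9" by algebra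
        finally show ?thesis by simp
      qed
      hence "(sum w A + lam * (1 - m)) * (2 / 9) \<le> (sum w A + lam * (1 - m)) * (m * (1 - m))"
        using wA lam m by (intro mult_left_mono add_nonneg_nonneg mult_nonneg_nonneg) auto
      ultimately show ?thesis by simp
    next
      case False
      \<comment> \<open>Here \<open>j\<close> alone weighs more than \<open>1 / 3\<close>, so its
        density is at most \<open>3 * L\<close>; the packed items add at most
        \<open>3 / 2 * L\<close>. The sum is again \<open>9 / 2 * L\<close>.\<close>
      have "lam * (1 / 3) \<le> lam * mu j" using big False lam by (intro mult_left_mono) auto
      hence "lam \<le> 3 * L" using lam_j single[OF j(1)] by simp
      moreover have "lam * (1 - m) \<le> lam" using lam m by (intro mult_left_le) auto
      moreover have "sum w A * (2 / 3) \<le> sum w A * (1 - m)"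
        using False wA by (intro mult_left_mono) auto
      ultimately show ?thesis using small_A by simp
    qed
    thus ?thesis
      using lam total by (intro exI[of _ lam]) (simp add: algebra_simps)
  qed
qed

section \<open>Comparison of the adaptive and non-adaptive optima\<close>

text \<open>This is \<open>policy_payoff_bound\<close> for the empty knapsack, with the potential
  replaced by a linear bound in the dual objective.\<close>

lemma risky_opt_le_dual:
  assumes I: "knapsack_instance I" and L: "0 \<le> L"
    and single: "\<And>i. i < item_count I \<Longrightarrow> item_value I i * measure (size_distr I i) {..1} \<le> L"
    and lam: "0 < lam"
  shows "risky_opt k I \<le> ennreal (L + 3 * exp (- 1) *
    ((\<Sum>i<item_count I. max 0 (item_value I i * measure (size_distr I i) {..1}
       - lam * (\<integral>x. min x 1 \<partial>size_distr I i))) + lam))"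
proof -
  let ?n = "item_count I"
  \<comment> \<open>Indices outside the instance get the point mass at 0, since the product locale
    asks for a probability measure at every index.\<close>
  define M where "M = (\<lambda>i. if i < ?n then size_distr I i else return borel 0)"
  have M: "real_distribution (M i)" for i
    using knapsack_instanceD[OF I, of i]
    by (auto simp: M_def real_distribution_def real_distribution_axioms_def prob_space_return)
  have sizes: "sizes_space I = PiM {..<?n} M"
    unfolding sizes_space_def by (intro PiM_cong) (auto simp: M_def)
  define D where "D = (\<Sum>i<?n. max 0 (item_value I i * measure (size_distr I i) {..1}
       - lam * (\<integral>x. min x 1 \<partial>size_distr I i)))"
  have D: "(\<Sum>i<?n. max 0 (item_value I i * measure (M i) {..1}
       - lam * (\<integral>x. min x 1 \<partial>M i))) = D"
    unfolding D_def by (intro sum.cong) (auto simp: M_def)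
  have D0: "0 \<le> D" unfolding D_def by (intro sum_nonneg) auto
  \<comment> \<open>The value at 0 is \<open>3 / e\<close>, and the slope is at most
    \<open>1 \<le> 3 / e\<close>; hence the common factor \<open>3 / e\<close> for \<open>D\<close>
    and \<open>lam\<close>.\<close>
  have "potential 1 (D / lam) \<le> potential 1 0 + (D / lam - 0)"
    using D0 lam by (intro potential_lipschitz) auto
  also have "potential 1 0 = 3 * exp (- 1)" by (simp add: potential_le_1)
  finally have "lam * potential 1 (D / lam) \<le> lam * (3 * exp (- 1) + D / lam)"
    using lam by (intro mult_left_mono) auto
  also have "\<dots> = 3 * exp (- 1) * lam + 1 * D"
    using lam by (simp add: field_simps)
  also have "1 * D \<le> 3 * exp (- 1) * D"
    using exp_le D0 by (intro mult_right_mono) (auto simp: exp_minus field_simps)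
  finally have pot: "lam * potential 1 (D / lam) \<le> 3 * exp (- 1) * (D + lam)"
    by (simp add: algebra_simps)
  show ?thesis
    unfolding risky_opt_def
  proof (rule SUP_least)
    fix p assume p: "p \<in> policies I k"
    have "(\<integral>\<^sup>+ s. ennreal (payoff_from (item_value I) p s 0 0) \<partial>PiM {..<?n} M)
            \<le> ennreal (L + lam * potential (1 - 0) ((0 + (\<Sum>i<?n. max 0 (item_value I i * measure (M i) {..1}
       - lam * (\<integral>x. min x 1 \<partial>M i)))) / lam))"
    proof (rule policy_payoff_bound[OF M lam L, where k = k])
      fix i assume "i \<in> {..<?n}"
      thus "(AE y in M i. 0 \<le> y) \<and> 0 \<le> item_value I i \<and> item_value I i * measure (M i) {..1} \<le> L"
        using knapsack_instanceD(1,5)[OF I, of i] single[of i] unfolding M_def by simp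
    qed (use p in \<open>auto simp: policies_def sizes\<close>)
    also have "\<dots> = ennreal (L + lam * potential 1 (D / lam))"
      unfolding D by simp
    also have "\<dots> \<le> ennreal (L + 3 * exp (- 1) * (D + lam))"
      using pot by (intro ennreal_leI) simp
    finally show "(\<integral>\<^sup>+ s. ennreal (risky_payoff I p s) \<partial>sizes_space I)
      \<le> ennreal (L + 3 * exp (- 1) * ((\<Sum>i<?n. max 0 (item_value I i * measure (size_distr I i) {..1}
       - lam * (\<integral>x. min x 1 \<partial>size_distr I i))) + lam))"
      by (simp add: risky_payoff_conv_payoff_from sizes D_def)
  qed
qed

lemma risky_opt_le_nonadaptive:
  assumes I: "knapsack_instance I"
  shows "risky_opt k I \<le> ennreal (2 * exp 1 + 1) * risky_opt 0 I"
proof (cases "risky_opt 0 I = top")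
  case True
  thus ?thesis by (simp add: ennreal_mult_top add_pos_pos)
next
  case False
  then obtain L where L: "0 \<le> L" and opt: "risky_opt 0 I = ennreal L"
    by (cases "risky_opt 0 I") auto
  define w where "w = (\<lambda>i. item_value I i * measure (size_distr I i) {..1})"
  define mu where "mu = (\<lambda>i. \<integral>x. min x 1 \<partial>size_distr I i)"
  have mu: "0 \<le> mu i" if "i < item_count I" for i
    unfolding mu_def using knapsack_instanceD(5)[OF I that]
    by (intro integral_nonneg_AE) auto
  have w: "0 \<le> w i" "w i \<le> L" if "i < item_count I" for i
    using knapsack_instanceD(1)[OF I that] risky_opt_ge_single_item[OF I that, of 0] L
    by (auto simp: w_def opt)
  have small: "sum w A * (1 - sum mu A) \<le> L" if "A \<subseteq> {..<item_count I}" for A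
    using risky_opt_ge_small_set[OF I that, of 0] L by (auto simp: w_def mu_def opt)
  obtain lam where lam: "0 \<le> lam" "(\<Sum>i<item_count I. max 0 (w i - lam * mu i)) + lam \<le> 9 / 2 * L"
    using fractional_knapsack_bound[of "{..<item_count I}" w mu L] w mu small L by auto
  have exp1: "3 * exp (- 1) \<le> (2::real)" "27 / 2 * exp (- 1) \<le> 2 * (exp 1 :: real)"
  proof -
    \<comment> \<open>The second inequality amounts to \<open>e * e \<ge> 27 / 4 = 6.75\<close>, and
      \<open>13 / 5\<close> squared is 6.76. The Taylor bound
      \<open>exp (1 / 2) \<ge> 1 + 1 / 2 + 1 / 8 = 13 / 8\<close> gives
      \<open>e \<ge> 169 / 64 > 13 / 5\<close>.\<close>
    have "(13 / 8)\<^sup>2 \<le> (exp (1 / 2) :: real)\<^sup>2"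
      using exp_lower_Taylor_quadratic[of "1 / 2 :: real"]
      by (intro power_mono) (auto simp: power2_eq_square)
    hence e: "(13 / 5 :: real) \<le> exp 1"
      by (simp add: power2_eq_square flip: exp_add)
    show "3 * exp (- 1) \<le> (2::real)"
      using e by (simp add: exp_minus field_simps)
    have "(13 / 5 :: real) * (13 / 5) \<le> exp 1 * exp 1"
      using e by (intro mult_mono) auto
    thus "27 / 2 * exp (- 1) \<le> 2 * (exp 1 :: real)"
      by (simp add: exp_minus field_simps)
  qed
  have "risky_opt k I \<le> ennreal ((2 * exp 1 + 1) * L)"
  proof (rule ennreal_le_epsilon)
    fix d :: real assume d: "0 < d"
    \<comment> \<open>\<open>lam\<close> may be 0, whereas \<open>risky_opt_le_dual\<close> divides
      by its multiplier. Shifting it by \<open>d / 2\<close> costs at most \<open>d\<close>, as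
      \<open>3 / e \<le> 2\<close>.\<close>
    have "(\<Sum>i<item_count I. max 0 (w i - (lam + d / 2) * mu i))
            \<le> (\<Sum>i<item_count I. max 0 (w i - lam * mu i))"
      using mu d by (intro sum_mono max.mono diff_left_mono mult_right_mono) auto
    hence "(\<Sum>i<item_count I. max 0 (w i - (lam + d / 2) * mu i)) + (lam + d / 2) \<le> 9 / 2 * L + d / 2"
      using lam by simp
    hence "3 * exp (- 1) * ((\<Sum>i<item_count I. max 0 (w i - (lam + d / 2) * mu i)) + (lam + d / 2))
             \<le> 3 * exp (- 1) * (9 / 2 * L + d / 2)"
      by (intro mult_left_mono) auto
    also have "\<dots> = 27 / 2 * exp (- 1) * L + 3 * exp (- 1) * (d / 2)"
      by (simp add: algebra_simps)
    also have "\<dots> \<le> 2 * exp 1 * L + 2 * (d / 2)"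
      using exp1 L d by (intro add_mono mult_right_mono) auto
    finally have le: "L + 3 * exp (- 1) * ((\<Sum>i<item_count I. max 0 (w i - (lam + d / 2) * mu i)) + (lam + d / 2))
                    \<le> (2 * exp 1 + 1) * L + d"
      by (simp add: algebra_simps)
    have "risky_opt k I
        \<le> ennreal (L + 3 * exp (- 1) * ((\<Sum>i<item_count I. max 0 (w i - (lam + d / 2) * mu i)) + (lam + d / 2)))"
      unfolding w_def mu_def using I L w d lam by (intro risky_opt_le_dual) (auto simp: w_def)
    also have "\<dots> \<le> ennreal ((2 * exp 1 + 1) * L + d)"
      by (rule ennreal_leI[OF le])
    also have "\<dots> = ennreal ((2 * exp 1 + 1) * L) + ennreal d"
      using L d by (intro ennreal_plus) auto
    finally show "risky_opt k I \<le> ennreal ((2 * exp 1 + 1) * L) + ennreal d" .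
  qed
  thus ?thesis
    using L by (simp add: opt ennreal_mult)
qed

lemma risky_gap_0_le: "risky_gap 0 \<le> ennreal (2 * exp 1 + 1)"
  unfolding risky_gap_def
proof (rule SUP_least)
  fix I assume "I \<in> {I. knapsack_instance I}"
  hence le: "risky_adapt I \<le> ennreal (2 * exp 1 + 1) * risky_opt 0 I"
    unfolding risky_adapt_def by (intro risky_opt_le_nonadaptive) simp
  show "risky_adapt I / risky_opt 0 I \<le> ennreal (2 * exp 1 + 1)"
  proof (cases "risky_opt 0 I = 0")
    case True
    \<comment> \<open>A vanishing non-adaptive optimum forces the adaptive one to vanish, and
      \<open>0 / 0 = 0\<close>.\<close>
    thus ?thesis using le by simp
  next
    case False
    thus ?thesis using le by (intro divide_le_posI_ennreal) (auto simp: zero_less_iff_neq_zero mult.commute)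
  qed
qed

theorem mainTheorem4:
  "\<exists>(k :: real \<Rightarrow> nat) (B :: real) (c :: nat) (C :: real). 0 < B \<and> 0 < C \<and>
     (\<forall>\<epsilon>. 0 < \<epsilon> \<and> \<epsilon> < 1 \<longrightarrow>
        real (k \<epsilon>) \<le> B * (1 / \<epsilon>) * (1 + ln (1 / \<epsilon>)) ^ c \<and>
        risky_gap (k \<epsilon>) \<le> ennreal (2 * exp 1 + 1 + C * sqrt \<epsilon>))"
\<comment> \<open>The witnesses are the constant query count 0, \<open>B = C = 1\<close> and
  \<open>c = 0\<close>.\<close>
proof (rule exI[of _ "\<lambda>_. 0"], rule exI[of _ 1], rule exI[of _ 0], rule exI[of _ 1],
    intro conjI allI impI)
  fix \<epsilon> :: real assume "0 < \<epsilon> \<and> \<epsilon> < 1"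
  thus "real 0 \<le> 1 * (1 / \<epsilon>) * (1 + ln (1 / \<epsilon>)) ^ 0" by simp
  have "ennreal (2 * exp 1 + 1) \<le> ennreal (2 * exp 1 + 1 + 1 * sqrt \<epsilon>)"
    using \<open>0 < \<epsilon> \<and> \<epsilon> < 1\<close> by (intro ennreal_leI) simp
  thus "risky_gap 0 \<le> ennreal (2 * exp 1 + 1 + 1 * sqrt \<epsilon>)"
    using risky_gap_0_le by (rule order_trans[rotated])
qed simp_all

end
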